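(* Let $q\in\mathbb C^*$ with $q^2\ne1$ (either generic or a root of unity), and let $((a_{i,j}),(b_{i,j}))\in\Gamma_n^0$. Then, for suitable choice of the representatives of the two projective points, one of the following holds: (1) the matrix $(a_{i,j})$ has rank one and $b_{i,j}=q^{i+j}a_{i,j}$ for all $i,j$; or (2) $(a_{i,j})$ is of the block diagonal form $(a_{i,j})=\mathrm{diag}(0,\dots,0,D_1,0,\dots,0,D_2,0,\dots,0)$, where $D_1,D_2$ are (not necessarily square) rank one matrices, and $(b_{i,j})=\mathrm{diag}(0,\dots,0,T_1,0,\dots,0,T_2,0,\dots,0)$ with the same block positions, where $T_1=(q^{i+j}a_{i,j})$ on the block of $D_1$ and $T_2=(q^{i+j-2}a_{i,j})$ on the block of $D_2$ (here $i,j$ denote row and column indices in the full $n\times n$ matrix).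
   Context: $J^0_q(n)$ is the quadratic algebra with generators $J_{i,j}$, $1\le i,j\le n$, and relations $J_{i,j}J_{s,t}=q^{s+t-i-j}J_{s,t}J_{i,j}$ if $(s-i)(t-j)\le0$, and $q^{1-t+j}J_{i,j}J_{s,t}=q^{s-i-1}J_{s,t}J_{i,j}+(q-q^{-1})J_{i,t}J_{s,j}$ if $s>i$ and $t>j$. For a quadratic algebra $T(V)/(R)$, $R\subset V\otimes V$, with basis $(x_k)$ of $V$, an element $f=\sum\alpha_{k,l}x_k\otimes x_l$ defines $f(p,p')=\sum\alpha_{k,l}x_k(p)x_l(p')$ for $p,p'\in V^*$, and the associated variety is $\Gamma(R)=\{(p,p')\in\mathbb P(V^* )\times\mathbb P(V^* ): f(p,p')=0\ \forall f\in R\}$. Here $V$ has basis $J_{i,j}$ and points of $\mathbb P(V^* )$ are represented by nonzero complex $n\times n$ matrices up to scalars; $\Gamma_n^0$ is the associated variety of $J_q^0(n)$. Thus $((a_{i,j}),(b_{i,j}))\in\Gamma_n^0$ means that the relations hold with each product $J_{i,j}J_{s,t}$ replaced by $a_{i,j}b_{s,t}$. In a block diagonal form $\mathrm{diag}(0,\dots,0,D_1,0,\dots,0,D_2,0,\dots,0)$ blocks may be rectangular: $D_1$ occupies an interval of rows and an interval of columns, and $D_2$ occupies an interval of rows strictly below those of $D_1$ and an interval of columns strictly to the right of those of $D_1$; all other entries vanish. *)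

theory Defs
  imports
    Complex_Main
    "HOL-Library.Function_Algebras"
    "Jordan_Normal_Form.DL_Rank"
begin

section \<open>Tensors of degree two and associated varieties\<close>

text \<open>
  Fix a finite basis \<open>(x\<^sub>k)\<close> of \<open>V\<close>, indexed by \<open>k \<in> K\<close>. A tensor
  \<open>\<Sum> \<alpha>(k,l) x\<^sub>k \<otimes> x\<^sub>l\<close> is represented by its coefficient function \<open>\<alpha>\<close>, and a point
  \<open>p\<close> of the dual space by its coordinates \<open>p k = x\<^sub>k(p)\<close>, set to zero outside \<open>K\<close>.
\<close>

type_synonym 'k tensor2 = "'k \<times> 'k \<Rightarrow> complex"

definition scale_tensor :: "complex \<Rightarrow> 'k tensor2 \<Rightarrow> 'k tensor2" where
  "scale_tensor c f = (\<lambda>m. c * f m)"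

interpretation tensor2: Modules.module scale_tensor
  by unfold_locales (auto simp: scale_tensor_def fun_eq_iff algebra_simps)

definition basis_tensor :: "'k \<Rightarrow> 'k \<Rightarrow> 'k tensor2" where
  "basis_tensor k l = (\<lambda>m. if m = (k, l) then 1 else 0)"

definition eval_tensor ::
    "'k set \<Rightarrow> 'k tensor2 \<Rightarrow> ('k \<Rightarrow> complex) \<Rightarrow> ('k \<Rightarrow> complex) \<Rightarrow> complex" where
  "eval_tensor K f p p' = (\<Sum>k\<in>K. \<Sum>l\<in>K. f (k, l) * p k * p' l)"

text \<open>A projective point is the set of all its representatives.\<close>

definition proj_point :: "('k \<Rightarrow> complex) \<Rightarrow> ('k \<Rightarrow> complex) set" where
  "proj_point p = {(\<lambda>k. c * p k) | c. c \<noteq> 0}"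

definition proj_space :: "'k set \<Rightarrow> ('k \<Rightarrow> complex) set set" where
  "proj_space K = proj_point ` {p. (\<forall>k. k \<notin> K \<longrightarrow> p k = 0) \<and> (\<exists>k\<in>K. p k \<noteq> 0)}"

definition associated_variety ::
    "'k set \<Rightarrow> 'k tensor2 set \<Rightarrow> (('k \<Rightarrow> complex) set \<times> ('k \<Rightarrow> complex) set) set" where
  "associated_variety K R =
     {(P, P') \<in> proj_space K \<times> proj_space K.
        \<forall>f\<in>R. \<forall>p\<in>P. \<forall>p'\<in>P'. eval_tensor K f p p' = 0}"

section \<open>The quadratic algebra \<open>J\<^sup>0\<^sub>q(n)\<close>\<close>

definition J_index :: "nat \<Rightarrow> (nat \<times> nat) set" where
  "J_index n = {1..n} \<times> {1..n}"

abbreviation JJ :: "nat \<Rightarrow> nat \<Rightarrow> nat \<Rightarrow> nat \<Rightarrow> (nat \<times> nat) tensor2" where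
  "JJ i j s t \<equiv> basis_tensor (i, j) (s, t)"

definition J0_relators :: "nat \<Rightarrow> complex \<Rightarrow> (nat \<times> nat) tensor2 set" where
  "J0_relators n q =
     {JJ i j s t - scale_tensor (q powi (int s + int t - int i - int j)) (JJ s t i j) | i j s t.
        (i, j) \<in> J_index n \<and> (s, t) \<in> J_index n \<and>
        (int s - int i) * (int t - int j) \<le> 0} \<union>
     {scale_tensor (q powi (1 - int t + int j)) (JJ i j s t)
        - (scale_tensor (q powi (int s - int i - 1)) (JJ s t i j)
           + scale_tensor (q - inverse q) (JJ i t s j)) | i j s t.
        (i, j) \<in> J_index n \<and> (s, t) \<in> J_index n \<and> s > i \<and> t > j}"

definition Gamma0 :: "nat \<Rightarrow> complex \<Rightarrow>
    ((nat \<times> nat \<Rightarrow> complex) set \<times> (nat \<times> nat \<Rightarrow> complex) set) set" where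
  "Gamma0 n q = associated_variety (J_index n) (tensor2.span (J0_relators n q))"

section \<open>Matrices\<close>

text \<open>
  Generators \<open>J\<^sub>i\<^sub>j\<close> are indexed from 1, entries of type \<open>mat\<close> from 0.
\<close>

definition matrix_of :: "nat \<Rightarrow> (nat \<times> nat \<Rightarrow> complex) \<Rightarrow> complex mat" where
  "matrix_of n a = mat n n (\<lambda>(i, j). a (Suc i, Suc j))"

definition rank_one :: "complex mat \<Rightarrow> bool" where
  "rank_one A \<longleftrightarrow> vec_space.rank (dim_row A) A = 1"

text \<open>
  For a block \<open>D\<close> of a larger matrix \<open>a\<close> that is preceded by \<open>r\<close> rows and \<open>c\<close> columns,
  this is the block \<open>(q\<^bsup>i+j+e\<^esup> a\<^sub>i\<^sub>j)\<close>, where \<open>i\<close>, \<open>j\<close> are the 1-based indices in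
  the larger matrix.
\<close>

definition twisted_block :: "complex \<Rightarrow> int \<Rightarrow> nat \<Rightarrow> nat \<Rightarrow> complex mat \<Rightarrow> complex mat" where
  "twisted_block q e r c D =
     mat (dim_row D) (dim_col D)
       (\<lambda>(i, j). q powi (int (r + Suc i) + int (c + Suc j) + e) * D $$ (i, j))"

text \<open>
  The zero blocks are rectangular and may have no rows or no columns, so two blocks
  \<open>D\<^sub>1\<close>, \<open>D\<^sub>2\<close> occupy arbitrary intervals of rows and columns, with those of
  \<open>D\<^sub>2\<close> strictly below and strictly to the right of those of \<open>D\<^sub>1\<close>.
\<close>

definition two_block_diag ::
    "nat \<times> nat \<Rightarrow> complex mat \<Rightarrow> nat \<times> nat \<Rightarrow> complex mat \<Rightarrow> nat \<times> nat \<Rightarrow> complex mat" where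
  "two_block_diag z0 D1 z1 D2 z2 =
     diag_block_mat
       [0\<^sub>m (fst z0) (snd z0), D1, 0\<^sub>m (fst z1) (snd z1), D2, 0\<^sub>m (fst z2) (snd z2)]"

end

theory Submission
  imports Defs
begin

text \<open>
  Write \<open>Q = q\<^sup>2\<close> and absorb the powers of \<open>q\<close> into the second matrix by
  \<open>c\<^sub>i\<^sub>j = q\<^bsup>-i-j\<^esup> b\<^sub>i\<^sub>j\<close>. At each position \<open>x\<close> of the matrices consider the vector
  \<open>v\<^sub>x = (a\<^sub>x, c\<^sub>x)\<close> in the plane. The first family of relations says that \<open>v\<^sub>x\<close> and \<open>v\<^sub>y\<close>
  are parallel unless one of the positions lies strictly above and strictly to the left of the other;
  write \<open>x \<prec> y\<close> for this. The second family becomes, for \<open>x = (i,j) \<prec> y = (s,t)\<close>,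
  \<open>Q a\<^sub>x c\<^sub>y - a\<^sub>y c\<^sub>x = (Q - 1) a\<^sub>i\<^sub>t c\<^sub>s\<^sub>j\<close>.

  If all \<open>v\<^sub>x\<close> are parallel, then \<open>c\<close> is a multiple of \<open>a\<close>, and the second family says that
  all two by two minors of \<open>a\<close> vanish: this is the first alternative.

  Otherwise let \<open>x \<prec> y\<close> with \<open>v\<^sub>x\<close>, \<open>v\<^sub>y\<close> not parallel. The vector at the corner
  \<open>(i,t)\<close> is parallel to both, hence zero, and so the slope \<open>c/a\<close> at \<open>x\<close> is exactly \<open>Q\<close>
  times the slope at \<open>y\<close> (\<open>slope_ratio\<close>). The slope cannot change twice along a chain
  \<open>x \<prec> y \<prec> z\<close> (\<open>no_nonparallel_chain\<close>). Consequently exactly two slopes occur, and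
  all positions of one slope lie strictly above and to the left of all positions of the other
  (\<open>support_splits\<close>); cutting the matrix between them gives two blocks, on each of which \<open>c\<close>
  is a multiple of \<open>a\<close>, so that each has rank one as before. The ratio \<open>Q = q\<^sup>2\<close> of the slopes
  is the shift by \<open>-2\<close> in the exponent of the second block.
\<close>

section \<open>Evaluation of the relators\<close>

lemma eval_basis_tensor:
  assumes "finite K" "k \<in> K" "l \<in> K"
  shows "eval_tensor K (basis_tensor k l) p p' = p k * p' l"
proof -
  have "eval_tensor K (basis_tensor k l) p p'
      = (\<Sum>k'\<in>K. \<Sum>l'\<in>K. if l' = l then if k' = k then p k * p' l else 0 else 0)"
    unfolding eval_tensor_def basis_tensor_def by (intro sum.cong refl) auto
  also have "\<dots> = p k * p' l"
    using assms by (simp add: sum.delta)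
  finally show ?thesis .
qed

lemma eval_tensor_linear:
  "eval_tensor K (f + g) p p' = eval_tensor K f p p' + eval_tensor K g p p'"
  "eval_tensor K (f - g) p p' = eval_tensor K f p p' - eval_tensor K g p p'"
  "eval_tensor K (scale_tensor c f) p p' = c * eval_tensor K f p p'"
  by (simp_all add: eval_tensor_def scale_tensor_def algebra_simps sum.distrib sum_subtractf
      sum_distrib_left)

section \<open>Slopes of a pair of matrices\<close>

text \<open>
  The relations of \<open>J\<^sup>0\<^sub>q(n)\<close> after the substitution \<open>Q = q\<^sup>2\<close>,
  \<open>c\<^sub>i\<^sub>j = q\<^bsup>-i-j\<^esup> b\<^sub>i\<^sub>j\<close>. The indices range over all natural numbers: matrices extended by zero still
  satisfy the relations, because a position outside the square makes both sides vanish.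
\<close>

locale twisted_pair =
  fixes Q :: complex and a c :: "nat \<times> nat \<Rightarrow> complex"
  assumes Q_nonzero: "Q \<noteq> 0" and Q_not_one: "Q \<noteq> 1"
    and anti: "\<And>i j s t. i \<le> s \<Longrightarrow> t \<le> j \<Longrightarrow> a (i, j) * c (s, t) = a (s, t) * c (i, j)"
    and diag: "\<And>i j s t. i < s \<Longrightarrow> j < t \<Longrightarrow>
      Q * (a (i, j) * c (s, t)) - a (s, t) * c (i, j) = (Q - 1) * (a (i, t) * c (s, j))"
begin

definition nonparallel :: "nat \<times> nat \<Rightarrow> nat \<times> nat \<Rightarrow> bool" where
  "nonparallel x y \<longleftrightarrow> a x * c y \<noteq> a y * c x"

definition support :: "(nat \<times> nat) set" where
  "support = {x. a x \<noteq> 0 \<or> c x \<noteq> 0}"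

definition before :: "nat \<times> nat \<Rightarrow> nat \<times> nat \<Rightarrow> bool" (infix "\<prec>" 50) where
  "x \<prec> y \<longleftrightarrow> fst x < fst y \<and> snd x < snd y"

lemma nonparallel_sym: "nonparallel x y \<longleftrightarrow> nonparallel y x"
  unfolding nonparallel_def by auto

text \<open>
  Parallelism is transitive through nonzero vectors; this is the contrapositive form in which it is
  needed.
\<close>

lemma nonparallel_cong:
  assumes "z \<in> support" "\<not> nonparallel x z" "nonparallel x y"
  shows "nonparallel z y"
  unfolding nonparallel_def
proof
  have xz: "a x * c z = a z * c x" and xy: "a x * c y - a y * c x \<noteq> 0"
    using assms by (auto simp: nonparallel_def)
  assume zy: "a z * c y = a y * c z"
  have "a z * (a x * c y - a y * c x) = 0" "c z * (a x * c y - a y * c x) = 0"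
    using xz zy by Groebner_Basis.algebra+
  then show False using xy assms(1) by (simp add: support_def)
qed

lemma nonparallel_comparable:
  assumes "nonparallel x y"
  shows "x \<prec> y \<or> y \<prec> x"
proof (rule ccontr)
  assume "\<not> ?thesis"
  then have "(fst x \<le> fst y \<and> snd y \<le> snd x) \<or> (fst y \<le> fst x \<and> snd x \<le> snd y)"
    unfolding before_def by linarith
  then have "a x * c y = a y * c x"
    using anti[of "fst x" "fst y" "snd y" "snd x"] anti[of "fst y" "fst x" "snd x" "snd y"] by auto
  then show False using assms by (simp add: nonparallel_def)
qed

text \<open>
  The corner \<open>(i,t)\<close> of the rectangle spanned by \<open>x = (i,j)\<close> and \<open>y = (s,t)\<close> is
  comparable with neither \<open>x\<close> nor \<open>y\<close>, so its vector is parallel to two independent vectors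
  and must vanish. This kills the right-hand side of \<open>diag\<close>. If one of the two
  products that remain were zero, so would be the other, and \<open>v\<^sub>x\<close>, \<open>v\<^sub>y\<close> would be parallel.
\<close>

lemma slope_ratio:
  assumes "nonparallel x y" "x \<prec> y"
  shows "Q * (a x * c y) = a y * c x"
    and "a x \<noteq> 0" "a y \<noteq> 0" "c x \<noteq> 0" "c y \<noteq> 0"
proof -
  obtain i j s t where x: "x = (i, j)" and y: "y = (s, t)" by (cases x, cases y)
  have lt: "i < s" "j < t" using assms(2) by (auto simp: x y before_def)
  have np: "a (i, j) * c (s, t) - a (s, t) * c (i, j) \<noteq> 0"
    using assms(1) by (simp add: nonparallel_def x y)
  have "a (i, t) * c (i, j) = a (i, j) * c (i, t)" "a (i, t) * c (s, t) = a (s, t) * c (i, t)"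
    using anti[of i i j t] anti[of i s t t] lt by auto
  then have "a (i, t) * (a (i, j) * c (s, t) - a (s, t) * c (i, j)) = 0" by Groebner_Basis.algebra
  then have "a (i, t) = 0" using np by simp
  then show ratio: "Q * (a x * c y) = a y * c x" using diag[OF lt] by (simp add: x y)
  have "a x * c y \<noteq> 0"
    using ratio np Q_nonzero by (auto simp: x y)
  moreover have "a y * c x \<noteq> 0"
    using ratio calculation Q_nonzero by (metis mult_eq_0_iff)
  ultimately show "a x \<noteq> 0" "a y \<noteq> 0" "c x \<noteq> 0" "c y \<noteq> 0" by auto
qed

text \<open>
  If the outer vectors are also independent, the slope ratio from \<open>x\<close> to \<open>z\<close> would be both
  \<open>Q\<close> and \<open>Q\<^sup>2\<close>. If they are parallel, that ratio is \<open>1 = Q\<^sup>2\<close>, which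
  is consistent when \<open>Q = -1\<close>, and another argument is needed: \<open>diag\<close> forces a nonzero entry at the upper
  right corner of the rectangle spanned by \<open>x\<close> and \<open>z\<close>; its vector has the slope of \<open>x\<close>,
  so it is independent of that of \<open>y\<close>, although the corner lies above and to the right of
  \<open>y\<close>.
\<close>

lemma no_nonparallel_chain:
  assumes "nonparallel x y" "x \<prec> y" "nonparallel y z" "y \<prec> z"
  shows False
proof -
  note xy = slope_ratio[OF assms(1,2)] and yz = slope_ratio[OF assms(3,4)]
  have "x \<prec> z" using assms(2,4) by (auto simp: before_def)
  show False
  proof (cases "nonparallel x z")
    case True
    note xz = slope_ratio[OF True \<open>x \<prec> z\<close>]
    have "(a y * c y * (a x * c z)) * (Q * (Q - 1)) = 0"
      using xy(1) yz(1) xz(1) by Groebner_Basis.algebra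
    then show False using xy yz xz Q_nonzero Q_not_one by simp
  next
    case False
    define w where "w = (fst x, snd z)"
    have "(Q - 1) * (a x * c z) = (Q - 1) * (a w * c (fst z, snd x))"
      using diag[of "fst x" "fst z" "snd x" "snd z"] \<open>x \<prec> z\<close> False
      by (simp add: before_def nonparallel_def w_def algebra_simps)
    then have "a w \<noteq> 0" using xy yz Q_not_one by auto
    then have "w \<in> support" by (simp add: support_def)
    moreover have "\<not> nonparallel x w"
      using anti[of "fst w" "fst x" "snd x" "snd w"] \<open>x \<prec> z\<close>
      by (auto simp: w_def nonparallel_def before_def)
    ultimately have "nonparallel w y" using nonparallel_cong assms(1) by blast
    then show False
      using nonparallel_comparable[of w y] assms(2,4) by (auto simp: before_def w_def)
  qed
qed

text \<open>
  Substituting \<open>c = m a\<close> turns \<open>diag\<close> into \<open>m (Q - 1)\<close> times the minor; the corner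
  \<open>(i, t)\<close> enters \<open>diag\<close> only through \<open>a\<close>.
\<close>

lemma minor_eq_zero:
  assumes "i < s" "j < t" "m \<noteq> 0"
    and "c (i, j) = m * a (i, j)" "c (s, j) = m * a (s, j)" "c (s, t) = m * a (s, t)"
  shows "a (i, j) * a (s, t) = a (i, t) * a (s, j)"
proof -
  have "(m * (Q - 1)) * (a (i, j) * a (s, t) - a (i, t) * a (s, j)) = 0"
    using diag[OF assms(1,2)] unfolding assms(4-6) by Groebner_Basis.algebra
  then show ?thesis using assms(3) Q_not_one by simp
qed

text \<open>
  The support is covered by the positions \<open>U\<close> with the slope of \<open>x\<close> and \<open>L\<close> with the slope
  of \<open>y\<close>, since a third slope would complete \<open>x \<prec> y\<close> to a forbidden chain. For
  \<open>u\<close> in \<open>U\<close> and \<open>w\<close> in \<open>L\<close> the order \<open>w \<prec> u\<close> is impossible: as \<open>u\<close> is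
  comparable with \<open>y\<close>, it would produce one of the chains \<open>w \<prec> u \<prec> y\<close> and
  \<open>x \<prec> y \<prec> u\<close>. The cut \<open>(R, C)\<close> is placed at the first row and the first
  column that \<open>L\<close> meets.
\<close>

lemma support_splits:
  assumes np: "nonparallel x y" and "x \<prec> y"
  obtains l R C where "l \<noteq> 0" "x \<prec> (R, C)" "R \<le> fst y" "C \<le> snd y"
    "\<And>i j. (i, j) \<in> support \<Longrightarrow> i < R \<and> j < C \<or> R \<le> i \<and> C \<le> j"
    "\<And>i j. i < R \<Longrightarrow> j < C \<Longrightarrow> c (i, j) = l * a (i, j)"
    "\<And>i j. R \<le> i \<Longrightarrow> C \<le> j \<Longrightarrow> c (i, j) = l / Q * a (i, j)"
proof -
  note xy = slope_ratio[OF assms]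
  define U where "U = {z \<in> support. \<not> nonparallel x z}"
  define L where "L = {z \<in> support. \<not> nonparallel y z}"
  have xU: "x \<in> U" and yL: "y \<in> L"
    using xy by (auto simp: U_def L_def support_def nonparallel_def)
  have cover: "z \<in> U \<or> z \<in> L" if z: "z \<in> support" for z
  proof (rule ccontr)
    assume "\<not> ?thesis"
    then have n: "nonparallel x z" "nonparallel z x" "nonparallel y z" "nonparallel z y"
      using z nonparallel_sym by (auto simp: U_def L_def)
    then show False
      using nonparallel_comparable[of x z] nonparallel_comparable[of y z] np \<open>x \<prec> y\<close>
        no_nonparallel_chain by blast
  qed
  have UL: "u \<prec> w" if u: "u \<in> U" and w: "w \<in> L" for u w
  proof (rule ccontr)
    assume "\<not> u \<prec> w"
    have uy: "nonparallel u y" using u np nonparallel_cong[of u x y] by (auto simp: U_def)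
    then have wu: "nonparallel w u"
      using w nonparallel_cong[of w y u] nonparallel_sym by (auto simp: L_def)
    then have "w \<prec> u" using \<open>\<not> u \<prec> w\<close> nonparallel_comparable by blast
    show False
      using nonparallel_comparable[OF uy] nonparallel_sym uy wu \<open>w \<prec> u\<close> np \<open>x \<prec> y\<close>
        no_nonparallel_chain by blast
  qed
  define R where "R = (LEAST i. i \<in> fst ` L)"
  define C where "C = (LEAST j. j \<in> snd ` L)"
  have "R \<in> fst ` L" "C \<in> snd ` L"
    unfolding R_def C_def using yL by (auto intro: LeastI)
  then have U_less: "u \<prec> (R, C)" if "u \<in> U" for u
    using UL[OF that] by (auto simp: before_def)
  have L_ge: "R \<le> fst w" "C \<le> snd w" if "w \<in> L" for w
    using that by (auto simp: R_def C_def intro!: Least_le)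
  show thesis
  proof (rule that[of "c x / a x" R C])
    show "c x / a x \<noteq> 0" using xy by simp
    show "x \<prec> (R, C)" by (rule U_less[OF xU])
    show "R \<le> fst y" "C \<le> snd y" using L_ge[OF yL] .
    show "i < R \<and> j < C \<or> R \<le> i \<and> C \<le> j" if "(i, j) \<in> support" for i j
      using cover[OF that] U_less[of "(i, j)"] L_ge[of "(i, j)"] by (auto simp: before_def)
    show "c (i, j) = c x / a x * a (i, j)" if "i < R" "j < C" for i j
    proof (cases "(i, j) \<in> support")
      case True
      then have "(i, j) \<in> U" using cover[OF True] L_ge[of "(i, j)"] that by auto
      then show ?thesis using xy by (simp add: U_def nonparallel_def field_simps)
    qed (simp add: support_def)
    show "c (i, j) = c x / a x / Q * a (i, j)" if "R \<le> i" "C \<le> j" for i j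
    proof (cases "(i, j) \<in> support")
      case True
      then have "(i, j) \<in> L" using cover[OF True] U_less[of "(i, j)"] that by (auto simp: before_def)
      then have "a y * c (i, j) = a (i, j) * c y" by (simp add: L_def nonparallel_def)
      then have "a y * (Q * a x * c (i, j)) = a y * (c x * a (i, j))"
        using xy(1) by Groebner_Basis.algebra
      then have "Q * a x * c (i, j) = c x * a (i, j)" using xy by simp
      then show ?thesis using xy Q_nonzero by (simp add: field_simps)
    qed (simp add: support_def)
  qed
qed

end

section \<open>Rank one matrices and block forms\<close>

lemma (in vec_space) rank_pos:
  assumes A: "A \<in> carrier_mat n nc" and "r < n" "k < nc" "A $$ (r, k) \<noteq> 0"
  shows "rank A \<ge> 1"
proof -
  have v: "col A k \<in> carrier_vec n" using A by auto
  have "col A k $ r \<noteq> 0" using assms by simp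
  have "lin_indpt {col A k}"
  proof (rule finite_lin_indpt2)
    fix u assume "lincomb u {col A k} = 0\<^sub>v n"
    then have "u (col A k) \<cdot>\<^sub>v col A k = 0\<^sub>v n" using v by (simp add: lincomb_def)
    then have "(u (col A k) \<cdot>\<^sub>v col A k) $ r = 0" using assms(2) by simp
    moreover have "(u (col A k) \<cdot>\<^sub>v col A k) $ r = u (col A k) * col A k $ r"
      using A assms(2) by (intro index_smult_vec) auto
    ultimately show "\<forall>w\<in>{col A k}. u w = 0" using \<open>col A k $ r \<noteq> 0\<close> by (simp del: index_col)
  qed (use v in auto)
  moreover have "{col A k} \<subseteq> set (cols A)"
    using A assms(3) unfolding cols_def by (simp del: index_col)
  ultimately show ?thesis using rank_ge_card_indpt[OF A, of "{col A k}"] by simp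
qed

text \<open>
  With a nonzero pivot at \<open>(r, k)\<close>, the minors through the pivot alone exhibit the matrix as the
  product of its column \<open>k\<close> and its row \<open>r\<close>, divided by the pivot.
\<close>

lemma rank_oneI:
  assumes A: "A \<in> carrier_mat nr nc"
    and rk: "r < nr" "k < nc" "A $$ (r, k) \<noteq> 0"
    and minors: "\<And>i j s t. i < s \<Longrightarrow> s < nr \<Longrightarrow> j < t \<Longrightarrow> t < nc \<Longrightarrow>
      A $$ (i, j) * A $$ (s, t) = A $$ (i, t) * A $$ (s, j)"
  shows "rank_one A"
proof -
  interpret vec_space "TYPE(complex)" nr .
  have prod: "A $$ (i, j) * A $$ (r, k) = A $$ (i, k) * A $$ (r, j)" if "i < nr" "j < nc" for i j
  proof -
    consider "i = r" | "j = k" | "i < r" "j < k" | "i < r" "k < j" | "r < i" "j < k" | "r < i" "k < j"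
      by linarith
    then show ?thesis
      using that rk minors[of i r j k] minors[of i r k j] minors[of r i j k] minors[of r i k j]
      by cases (auto simp: mult.commute)
  qed
  have "rank A \<le> 1"
  proof (rule rank_le_1_product_entries[OF A])
    fix i j assume "i < dim_row A" "j < dim_col A"
    then show "A $$ (i, j) = A $$ (i, k) * (A $$ (r, j) / A $$ (r, k))"
      using prod[of i j] A rk by (simp add: field_simps)
  qed
  moreover have "rank A \<ge> 1" using rank_pos[OF A rk] .
  ultimately show ?thesis using A by (simp add: rank_one_def)
qed

text \<open>
  The blocks may be enlarged by zero rows and columns without changing their rank, so it is enough
  to cut the matrix into four quadrants; the three zero blocks of the diagonal form are then empty.
\<close>

lemma two_block_diag_eqI:
  assumes M: "M \<in> carrier_mat n n" and RC: "R \<le> n" "C \<le> n"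
    and D1: "D1 \<in> carrier_mat R C" and D2: "D2 \<in> carrier_mat (n - R) (n - C)"
    and e1: "\<And>i j. i < R \<Longrightarrow> j < C \<Longrightarrow> D1 $$ (i, j) = M $$ (i, j)"
    and e2: "\<And>i j. i < n - R \<Longrightarrow> j < n - C \<Longrightarrow> D2 $$ (i, j) = M $$ (R + i, C + j)"
    and z: "\<And>i j. i < n \<Longrightarrow> j < n \<Longrightarrow> (i < R) \<noteq> (j < C) \<Longrightarrow> M $$ (i, j) = 0"
  shows "M = two_block_diag (0, 0) D1 (0, 0) D2 (0, 0)"
  unfolding two_block_diag_def
proof (rule eq_matI, goal_cases)
  case (1 i j)
  then show ?case
    using M RC D1 D2 e1[of i j] e2[of "i - R" "j - C"] z[of i j] by (auto simp: Let_def)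
qed (use M RC D1 D2 in \<open>auto simp: Let_def\<close>)

section \<open>The associated variety\<close>

text \<open>
  Every relator is an element of the span, so its evaluation vanishes at the chosen representatives.
  Dividing the first family by \<open>q\<^bsup>s+t\<^esup>\<close> and the second by \<open>q\<^bsup>s+j-1\<^esup>\<close> leaves the
  relations of \<^locale>\<open>twisted_pair\<close>.
\<close>

lemma Gamma0_twisted_pair:
  assumes q: "q \<noteq> 0" "q\<^sup>2 \<noteq> 1" and "(P, P') \<in> Gamma0 n q"
  obtains a b where "P = proj_point a" "P' = proj_point b"
    "\<forall>x. a x \<noteq> 0 \<longrightarrow> x \<in> J_index n" "\<exists>x. a x \<noteq> 0"
    "\<forall>x. b x \<noteq> 0 \<longrightarrow> x \<in> J_index n" "\<exists>x. b x \<noteq> 0"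
    "twisted_pair (q\<^sup>2) a (\<lambda>(i, j). inverse q ^ (i + j) * b (i, j))"
proof -
  define K where "K = J_index n"
  have fin: "finite K" by (simp add: K_def J_index_def)
  obtain a b where P: "P = proj_point a" "P' = proj_point b"
    and a: "\<And>x. x \<notin> K \<Longrightarrow> a x = 0" "\<exists>x\<in>K. a x \<noteq> 0"
    and b: "\<And>x. x \<notin> K \<Longrightarrow> b x = 0" "\<exists>x\<in>K. b x \<noteq> 0"
    using assms(3) unfolding Gamma0_def associated_variety_def proj_space_def K_def by blast
  have "a \<in> P" "b \<in> P'" unfolding P proj_point_def by (auto intro!: exI[of _ 1])
  then have rel: "eval_tensor K f a b = 0" if "f \<in> J0_relators n q" for f
    using assms(3) that tensor2.span_base[OF that] unfolding Gamma0_def associated_variety_def K_def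
    by blast
  define c where "c = (\<lambda>(i, j). inverse q ^ (i + j) * b (i, j))"
  have c: "b (i, j) = q ^ (i + j) * c (i, j)" for i j
    using q by (simp add: c_def power_inverse)
  have c0: "c x = 0" if "x \<notin> K" for x using b(1)[OF that] by (auto simp: c_def split: prod.splits)
  have "twisted_pair (q\<^sup>2) a c"
  proof
    show "q\<^sup>2 \<noteq> 0" "q\<^sup>2 \<noteq> 1" using q by simp_all
  next
    fix i j s t :: nat assume le: "i \<le> s" "t \<le> j"
    show "a (i, j) * c (s, t) = a (s, t) * c (i, j)"
    proof (cases "(i, j) \<in> K \<and> (s, t) \<in> K")
      case True
      have "(int s - int i) * (int t - int j) \<le> 0" using le by (simp add: mult_nonneg_nonpos)
      then have "JJ i j s t - scale_tensor (q powi (int s + int t - int i - int j)) (JJ s t i j)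
          \<in> J0_relators n q"
        using True unfolding J0_relators_def K_def by blast
      from rel[OF this] True
      have "a (i, j) * b (s, t) = q powi (int s + int t - int i - int j) * (a (s, t) * b (i, j))"
        by (simp add: eval_tensor_linear eval_basis_tensor fin)
      then have "q ^ (s + t) * (a (i, j) * c (s, t))
          = (q powi (int s + int t - int i - int j) * q ^ (i + j)) * (a (s, t) * c (i, j))"
        unfolding c by (simp only: ac_simps)
      also have "q powi (int s + int t - int i - int j) * q ^ (i + j) = q ^ (s + t)"
        using q by (simp add: power_int_diff power_int_add power_add field_simps)
      finally have "q ^ (s + t) * (a (i, j) * c (s, t)) = q ^ (s + t) * (a (s, t) * c (i, j))" .
      then show ?thesis using q by simp
    next
      case False
      then show ?thesis using a(1) c0 by auto
    qed
  next
    fix i j s t :: nat assume lt: "i < s" "j < t"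
    show "q\<^sup>2 * (a (i, j) * c (s, t)) - a (s, t) * c (i, j) = (q\<^sup>2 - 1) * (a (i, t) * c (s, j))"
    proof (cases "(i, j) \<in> K \<and> (s, t) \<in> K")
      case True
      then have K: "(i, t) \<in> K" "(s, j) \<in> K" by (auto simp: K_def J_index_def)
      have "scale_tensor (q powi (1 - int t + int j)) (JJ i j s t)
        - (scale_tensor (q powi (int s - int i - 1)) (JJ s t i j)
           + scale_tensor (q - inverse q) (JJ i t s j)) \<in> J0_relators n q"
        using True lt unfolding J0_relators_def K_def by blast
      from rel[OF this] True K
      have r: "q powi (1 - int t + int j) * (a (i, j) * b (s, t))
          - (q powi (int s - int i - 1) * (a (s, t) * b (i, j)) + (q - inverse q) * (a (i, t) * b (s, j))) = 0"
        by (simp add: eval_tensor_linear eval_basis_tensor fin)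
      have p: "q powi (1 - int t + int j) * q ^ (s + t) = q * q ^ (s + j)"
        "q powi (int s - int i - 1) * q ^ (i + j) = inverse q * q ^ (s + j)"
        using q by (simp_all add: power_int_diff power_int_add power_add field_simps)
      have clear: "z * (q\<^sup>2 * X - Y) = z * ((q\<^sup>2 - 1) * W)"
        if "q * z * X - (q' * z * Y + (q - q') * (z * W)) = 0" "q' * q = 1" for z q' X Y W
        using that by Groebner_Basis.algebra
      have "(q powi (1 - int t + int j) * q ^ (s + t)) * (a (i, j) * c (s, t))
          - ((q powi (int s - int i - 1) * q ^ (i + j)) * (a (s, t) * c (i, j))
             + (q - inverse q) * (q ^ (s + j) * (a (i, t) * c (s, j)))) = 0"
        using r unfolding c by (simp only: ac_simps)
      then have "q ^ (s + j) * (q\<^sup>2 * (a (i, j) * c (s, t)) - a (s, t) * c (i, j))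
          = q ^ (s + j) * ((q\<^sup>2 - 1) * (a (i, t) * c (s, j)))"
        unfolding p by (rule clear) (use q in simp)
      then show ?thesis using q by simp
    next
      case False
      then have "(i, t) \<notin> K \<or> (s, j) \<notin> K" using lt by (auto simp: K_def J_index_def)
      then show ?thesis using False a(1) c0 by auto
    qed
  qed
  then have tw: "twisted_pair (q\<^sup>2) a (\<lambda>(i, j). inverse q ^ (i + j) * b (i, j))"
    by (simp add: c_def)
  show thesis
    by (rule that[OF P _ _ _ _ tw]) (use a b in \<open>auto simp: K_def\<close>)
qed

theorem theorem8p4:
  fixes q :: complex and n :: nat
    and P P' :: "(nat \<times> nat \<Rightarrow> complex) set"
  assumes "q \<noteq> 0" and "q\<^sup>2 \<noteq> 1"
    and "(P, P') \<in> Gamma0 n q"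
  shows "\<exists>a\<in>P. \<exists>b\<in>P'.
      (rank_one (matrix_of n a) \<and>
        (\<forall>i\<in>{1..n}. \<forall>j\<in>{1..n}. b (i, j) = q ^ (i + j) * a (i, j))) \<or>
      (\<exists>r0 c0 D1 r1 c1 D2 r2 c2 T1 T2.
        rank_one D1 \<and> rank_one D2 \<and>
        matrix_of n a = two_block_diag (r0, c0) D1 (r1, c1) D2 (r2, c2) \<and>
        matrix_of n b = two_block_diag (r0, c0) T1 (r1, c1) T2 (r2, c2) \<and>
        T1 = twisted_block q 0 r0 c0 D1 \<and>
        T2 = twisted_block q (-2) (r0 + dim_row D1 + r1) (c0 + dim_col D1 + c1) D2)"
proof -
  obtain a b where P: "P = proj_point a" "P' = proj_point b"
    and a: "\<forall>x. a x \<noteq> 0 \<longrightarrow> x \<in> J_index n" "\<exists>x. a x \<noteq> 0"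
    and b: "\<forall>x. b x \<noteq> 0 \<longrightarrow> x \<in> J_index n" "\<exists>x. b x \<noteq> 0"
    and tw: "twisted_pair (q\<^sup>2) a (\<lambda>(i, j). inverse q ^ (i + j) * b (i, j))"
    using Gamma0_twisted_pair[OF assms] .
  define c where "c = (\<lambda>(i, j). inverse q ^ (i + j) * b (i, j))"
  interpret twisted_pair "q\<^sup>2" a c using tw by (simp add: c_def)
  have bc: "b (i, j) = q ^ (i + j) * c (i, j)" for i j
    using assms(1) by (simp add: c_def power_inverse)
  have aP: "a \<in> P" unfolding P proj_point_def by (auto intro!: exI[of _ 1])
  \<comment> \<open>Dividing by the common slope, or by the slope of the upper left block, makes it 1.\<close>
  have bP: "(\<lambda>x. b x / l) \<in> P'" if "l \<noteq> 0" for l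
    unfolding P proj_point_def using that by (auto intro!: exI[of _ "1 / l"])
  show ?thesis
  proof (cases "\<exists>x y. nonparallel x y")
    case False
    obtain x where x: "a x \<noteq> 0" using a by blast
    obtain r k where rk: "x = (Suc r, Suc k)" "r < n" "k < n"
    proof -
      have "x \<in> J_index n" using a(1) x by blast
      then show thesis
        by (intro that[of "fst x - 1" "snd x - 1"]) (auto simp: J_index_def)
    qed
    define l where "l = c x / a x"
    have ca: "c y = l * a y" for y
    proof -
      have "a x * c y = a y * c x" using False unfolding nonparallel_def by blast
      then show ?thesis using x by (simp add: l_def field_simps)
    qed
    obtain y where "b y \<noteq> 0" using b by blast
    then have l: "l \<noteq> 0" using ca bc by (cases y) auto
    have "rank_one (matrix_of n a)"
    proof (rule rank_oneI)
      show "matrix_of n a \<in> carrier_mat n n" by (simp add: matrix_of_def)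
      show "matrix_of n a $$ (r, k) \<noteq> 0" using rk x by (simp add: matrix_of_def)
    next
      fix i j s t assume "i < s" "s < n" "j < t" "t < n"
      then show "matrix_of n a $$ (i, j) * matrix_of n a $$ (s, t) = matrix_of n a $$ (i, t) * matrix_of n a $$ (s, j)"
        using minor_eq_zero[of "Suc i" "Suc s" "Suc j" "Suc t", OF _ _ l] ca by (simp add: matrix_of_def)
    qed (use rk in auto)
    moreover have "b (i, j) / l = q ^ (i + j) * a (i, j)" for i j
      using l by (simp add: bc ca)
    ultimately show ?thesis using aP bP[OF l] by (intro bexI[of _ a] bexI[of _ "\<lambda>x. b x / l"]) auto
  next
    case True
    then obtain x y where np: "nonparallel x y" "x \<prec> y"
      using nonparallel_comparable nonparallel_sym by blast
    obtain l R' C' where l: "l \<noteq> 0" and x: "x \<prec> (R', C')" and y: "R' \<le> fst y" "C' \<le> snd y"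
      and supp: "\<And>i j. (i, j) \<in> support \<Longrightarrow> i < R' \<and> j < C' \<or> R' \<le> i \<and> C' \<le> j"
      and c1: "\<And>i j. i < R' \<Longrightarrow> j < C' \<Longrightarrow> c (i, j) = l * a (i, j)"
      and c2: "\<And>i j. R' \<le> i \<Longrightarrow> C' \<le> j \<Longrightarrow> c (i, j) = l / q\<^sup>2 * a (i, j)"
      by (rule support_splits[OF np]) (rule that)
    \<comment> \<open>The cut \<open>(R', C')\<close> is in 1-based indices, so the first block has \<open>R' - 1\<close> rows
      and \<open>C' - 1\<close> columns.\<close>
    obtain R C where RC: "R' = Suc R" "C' = Suc C" using x by (cases R'; cases C') (auto simp: before_def)
    have axy: "a x \<noteq> 0" "a y \<noteq> 0" using slope_ratio[OF np] by auto
    obtain r k where rk: "x = (Suc r, Suc k)" "r < R" "k < C"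
    proof -
      have "x \<in> J_index n" using a(1) axy(1) by blast
      then show thesis
        using x RC by (intro that[of "fst x - 1" "snd x - 1"]) (auto simp: J_index_def before_def)
    qed
    obtain r' k' where rk': "y = (Suc (R + r'), Suc (C + k'))" "r' < n - R" "k' < n - C"
    proof -
      obtain s t where "y = (s, t)" "R' \<le> s" "C' \<le> t" "s \<le> n" "t \<le> n"
        using a(1) axy(2) y by (cases y) (auto simp: J_index_def)
      then show thesis by (intro that[of "s - R'" "t - C'"]) (auto simp: RC)
    qed
    have off: "(Suc i, Suc j) \<notin> support" if "(i < R) \<noteq> (j < C)" for i j
      using supp[of "Suc i" "Suc j"] that by (auto simp: RC)
    have le: "R \<le> n" "C \<le> n" using rk' by auto
    define D1 where "D1 = mat R C (\<lambda>(i, j). a (Suc i, Suc j))"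
    define D2 where "D2 = mat (n - R) (n - C) (\<lambda>(i, j). a (Suc (R + i), Suc (C + j)))"
    define b' where "b' = (\<lambda>x. b x / l)"
    have "rank_one D1"
    proof (rule rank_oneI)
      show "D1 \<in> carrier_mat R C" by (simp add: D1_def)
      show "D1 $$ (r, k) \<noteq> 0" using rk axy by (simp add: D1_def)
    next
      fix i j s t assume "i < s" "s < R" "j < t" "t < C"
      then show "D1 $$ (i, j) * D1 $$ (s, t) = D1 $$ (i, t) * D1 $$ (s, j)"
        using minor_eq_zero[of "Suc i" "Suc s" "Suc j" "Suc t", OF _ _ l] c1 RC by (simp add: D1_def)
    qed (use rk in auto)
    moreover have "rank_one D2"
    proof (rule rank_oneI)
      show "D2 \<in> carrier_mat (n - R) (n - C)" by (simp add: D2_def)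
      show "D2 $$ (r', k') \<noteq> 0" using rk' axy by (simp add: D2_def)
    next
      fix i j s t assume "i < s" "s < n - R" "j < t" "t < n - C"
      then show "D2 $$ (i, j) * D2 $$ (s, t) = D2 $$ (i, t) * D2 $$ (s, j)"
        using minor_eq_zero[of "Suc (R + i)" "Suc (R + s)" "Suc (C + j)" "Suc (C + t)"
            "l / q\<^sup>2"] l assms(1) c2 RC
        by (simp add: D2_def)
    qed (use rk' in auto)
    moreover have "matrix_of n a = two_block_diag (0, 0) D1 (0, 0) D2 (0, 0)"
    proof (rule two_block_diag_eqI[OF _ le])
      show "matrix_of n a $$ (i, j) = 0" if "i < n" "j < n" "(i < R) \<noteq> (j < C)" for i j
        using off[OF that(3)] that by (simp add: matrix_of_def support_def)
    qed (use le in \<open>auto simp: matrix_of_def D1_def D2_def\<close>)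
    moreover have "matrix_of n b' = two_block_diag (0, 0) (twisted_block q 0 0 0 D1)
        (0, 0) (twisted_block q (-2) R C D2) (0, 0)"
    proof (rule two_block_diag_eqI[OF _ le])
      show "matrix_of n b' $$ (i, j) = 0" if "i < n" "j < n" "(i < R) \<noteq> (j < C)" for i j
        using off[OF that(3)] that by (simp add: matrix_of_def support_def b'_def bc)
    next
      fix i j assume ij: "i < R" "j < C"
      have e: "q powi (int (Suc i) + int (Suc j)) = q ^ (Suc i + Suc j)"
        by (metis of_nat_add power_int_of_nat)
      show "twisted_block q 0 0 0 D1 $$ (i, j) = matrix_of n b' $$ (i, j)"
        using ij le c1[of "Suc i" "Suc j"] l e
        by (simp add: twisted_block_def D1_def matrix_of_def b'_def bc RC)
    next
      fix i j assume ij: "i < n - R" "j < n - C"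
      have e: "q powi (int (R + Suc i) + int (C + Suc j) + -2) = q ^ (Suc (R + i) + Suc (C + j)) / q\<^sup>2"
        using assms(1) power_int_diff[of q "int (R + Suc i) + int (C + Suc j)" 2]
          power_int_of_nat[of q "R + Suc i + (C + Suc j)"] by simp
      show "twisted_block q (-2) R C D2 $$ (i, j) = matrix_of n b' $$ (R + i, C + j)"
        using ij le c2[of "Suc (R + i)" "Suc (C + j)"] l e
        by (simp add: twisted_block_def D2_def matrix_of_def b'_def bc RC)
    qed (auto simp: matrix_of_def twisted_block_def D1_def D2_def)
    moreover have "dim_row D1 = R" "dim_col D1 = C" by (simp_all add: D1_def)
    ultimately have "\<exists>r0 c0 D1 r1 c1 D2 r2 c2 T1 T2.
        rank_one D1 \<and> rank_one D2 \<and>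
        matrix_of n a = two_block_diag (r0, c0) D1 (r1, c1) D2 (r2, c2) \<and>
        matrix_of n b' = two_block_diag (r0, c0) T1 (r1, c1) T2 (r2, c2) \<and>
        T1 = twisted_block q 0 r0 c0 D1 \<and>
        T2 = twisted_block q (-2) (r0 + dim_row D1 + r1) (c0 + dim_col D1 + c1) D2"
      by (intro exI[of _ 0] exI[of _ D1] exI[of _ D2] exI[of _ "twisted_block q 0 0 0 D1"]
          exI[of _ "twisted_block q (-2) R C D2"]) simp
    then show ?thesis using aP bP[OF l] unfolding b'_def by blast
  qed
qed

end
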